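(* Let $L$ be a lower real, i.e. an element of $\mathcal L=\mathrm{Idl}(\mathbb Q,<)$, and let $U=\{q\in\mathbb Q\mid\exists s\in\mathbb Q\setminus L,\ s<q\}$. Then $L$ is a sharp element of $\mathcal L$ if and only if the pair $(L,U)$ is located, i.e. for all rationals $p<q$ we have $p\in L$ or $q\in U$.
   Context: We work constructively: informal set theory without excluded middle or choice. $\mathcal L=\mathrm{Idl}(\mathbb Q,<)$ is the set of subsets $L\subseteq\mathbb Q$ that are lower sets ($q<p\in L$ implies $q\in L$) and directed (inhabited, and for $p,q\in L$ there is $r\in L$ with $p<r$ and $q<r$), ordered by inclusion; directed suprema are unions, and it is a continuous dcpo. In a dcpo, $x\ll y$ if for every directed $S$ with $y\sqsubseteq\bigsqcup S$ some $s\in S$ has $x\sqsubseteq s$. An element $x$ is sharp if for all $u,v$ with $u\ll v$, $u\ll x$ or $\neg(v\sqsubseteq x)$. *)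

theory Defs
  imports Complex_Main
begin

text \<open>
  In HOL itself excluded middle holds, and it makes every element of a dcpo sharp and every pair
  \<open>(L, U)\<close> as below located. The constructive notions are therefore interpreted
  with truth values in an arbitrary complete Heyting algebra \<open>'h\<close>, by the usual clauses of
  Heyting-valued set theory: a subset of \<open>X\<close> is a function from \<open>X\<close> to \<open>'h\<close> whose value at
  \<open>x\<close> is the truth value of membership of \<open>x\<close>, quantifiers are infima and suprema, and a
  sentence holds if its truth value is \<open>top\<close>. For \<open>'h = bool\<close> this is ordinary HOL.
\<close>

section \<open>Truth values in a complete Heyting algebra\<close>

class complete_heyting_algebra = complete_lattice +
  assumes inf_Sup_le: "inf a (Sup A) \<le> (SUP b\<in>A. inf a b)"

instance bool :: complete_heyting_algebra
  by standard auto

abbreviation hconj :: "'h::complete_heyting_algebra \<Rightarrow> 'h \<Rightarrow> 'h" (infixr "\<^bold>\<and>" 35)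
  where "a \<^bold>\<and> b \<equiv> inf a b"

abbreviation hdisj :: "'h::complete_heyting_algebra \<Rightarrow> 'h \<Rightarrow> 'h" (infixr "\<^bold>\<or>" 30)
  where "a \<^bold>\<or> b \<equiv> sup a b"

definition himp :: "'h::complete_heyting_algebra \<Rightarrow> 'h \<Rightarrow> 'h" (infixr "\<^bold>\<longrightarrow>" 25)
  where "(a \<^bold>\<longrightarrow> b) = Sup {c. inf c a \<le> b}"

abbreviation hiff :: "'h::complete_heyting_algebra \<Rightarrow> 'h \<Rightarrow> 'h" (infixr "\<^bold>\<longleftrightarrow>" 25)
  where "a \<^bold>\<longleftrightarrow> b \<equiv> (a \<^bold>\<longrightarrow> b) \<^bold>\<and> (b \<^bold>\<longrightarrow> a)"

abbreviation hnot :: "'h::complete_heyting_algebra \<Rightarrow> 'h" ("\<^bold>\<not> _" [40] 40)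
  where "\<^bold>\<not> a \<equiv> a \<^bold>\<longrightarrow> bot"

abbreviation hall :: "('a \<Rightarrow> 'h::complete_heyting_algebra) \<Rightarrow> 'h" (binder "\<^bold>\<forall>" 10)
  where "\<^bold>\<forall>x. P x \<equiv> (INF x. P x)"

abbreviation hex :: "('a \<Rightarrow> 'h::complete_heyting_algebra) \<Rightarrow> 'h" (binder "\<^bold>\<exists>" 10)
  where "\<^bold>\<exists>x. P x \<equiv> (SUP x. P x)"

abbreviation holds :: "'h::complete_heyting_algebra \<Rightarrow> bool"
  where "holds a \<equiv> a = top"

text \<open>
  The rationals have decidable equality and order, so they are interpreted by the type
  \<open>rat\<close> itself, with atomic formulas taking only the values \<open>top\<close> and \<open>bot\<close>.
\<close>

definition hless :: "rat \<Rightarrow> rat \<Rightarrow> 'h::complete_heyting_algebra" (infix "\<^bold><" 50)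
  where "(p \<^bold>< q) = (if p < q then top else bot)"

lemma le_himp_iff: "c \<le> (a \<^bold>\<longrightarrow> b) \<longleftrightarrow> inf c a \<le> b"
proof
  assume "c \<le> (a \<^bold>\<longrightarrow> b)"
  then have "inf c a \<le> inf a (Sup {c. inf c a \<le> b})"
    unfolding himp_def by (simp add: le_infI1)
  also have "\<dots> \<le> (SUP d\<in>{c. inf c a \<le> b}. inf a d)"
    by (rule inf_Sup_le)
  also have "\<dots> \<le> b"
    by (rule SUP_least) (simp add: inf_commute)
  finally show "inf c a \<le> b" .
next
  assume "inf c a \<le> b"
  then show "c \<le> (a \<^bold>\<longrightarrow> b)"
    unfolding himp_def by (auto intro: Sup_upper)
qed

lemma holds_himp_iff: "holds (a \<^bold>\<longrightarrow> b) \<longleftrightarrow> a \<le> b"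
  using le_himp_iff[of top a b] by (simp add: top_unique)

lemma himp_bool: "((a::bool) \<^bold>\<longrightarrow> b) = (a \<longrightarrow> b)"
  using holds_himp_iff[of a b] by auto

lemma hless_bool: "(p \<^bold>< q) = (p < q)"
  by (simp add: hless_def)


section \<open>Directed sets, suprema, the way-below relation and sharp elements\<close>

text \<open>
  A poset is given by the membership predicate \<open>D\<close> of its carrier and its order \<open>le\<close>; equality of
  its elements is \<open>le x y \<^bold>\<and> le y x\<close>. That a subset respects equality, automatic in set
  theory, has to be part of the definition of a subset.
\<close>

definition subset_of ::
  "('a \<Rightarrow> 'h::complete_heyting_algebra) \<Rightarrow> ('a \<Rightarrow> 'a \<Rightarrow> 'h) \<Rightarrow> ('a \<Rightarrow> 'h) \<Rightarrow> 'h"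
  where "subset_of D le S =
    ((\<^bold>\<forall>x. S x \<^bold>\<longrightarrow> D x) \<^bold>\<and>
     (\<^bold>\<forall>x. \<^bold>\<forall>y. S x \<^bold>\<and> D y \<^bold>\<and> le x y \<^bold>\<and> le y x \<^bold>\<longrightarrow> S y))"

definition directed_in ::
  "('a \<Rightarrow> 'h::complete_heyting_algebra) \<Rightarrow> ('a \<Rightarrow> 'a \<Rightarrow> 'h) \<Rightarrow> ('a \<Rightarrow> 'h) \<Rightarrow> 'h"
  where "directed_in D le S =
    (subset_of D le S \<^bold>\<and> (\<^bold>\<exists>x. S x) \<^bold>\<and>
     (\<^bold>\<forall>x. \<^bold>\<forall>y. S x \<^bold>\<and> S y \<^bold>\<longrightarrow> (\<^bold>\<exists>z. S z \<^bold>\<and> le x z \<^bold>\<and> le y z)))"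

definition is_sup ::
  "('a \<Rightarrow> 'h::complete_heyting_algebra) \<Rightarrow> ('a \<Rightarrow> 'a \<Rightarrow> 'h) \<Rightarrow> ('a \<Rightarrow> 'h) \<Rightarrow> 'a \<Rightarrow> 'h"
  where "is_sup D le S z =
    (D z \<^bold>\<and> (\<^bold>\<forall>x. S x \<^bold>\<longrightarrow> le x z) \<^bold>\<and>
     (\<^bold>\<forall>w. D w \<^bold>\<and> (\<^bold>\<forall>x. S x \<^bold>\<longrightarrow> le x w) \<^bold>\<longrightarrow> le z w))"

definition way_below ::
  "('a \<Rightarrow> 'h::complete_heyting_algebra) \<Rightarrow> ('a \<Rightarrow> 'a \<Rightarrow> 'h) \<Rightarrow> 'a \<Rightarrow> 'a \<Rightarrow> 'h"
  where "way_below D le x y =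
    (\<^bold>\<forall>S. directed_in D le S \<^bold>\<longrightarrow>
      (\<^bold>\<forall>z. is_sup D le S z \<^bold>\<and> le y z \<^bold>\<longrightarrow> (\<^bold>\<exists>s. S s \<^bold>\<and> le x s)))"

definition sharp ::
  "('a \<Rightarrow> 'h::complete_heyting_algebra) \<Rightarrow> ('a \<Rightarrow> 'a \<Rightarrow> 'h) \<Rightarrow> 'a \<Rightarrow> 'h"
  where "sharp D le x =
    (\<^bold>\<forall>u. \<^bold>\<forall>v. D u \<^bold>\<and> D v \<^bold>\<and> way_below D le u v \<^bold>\<longrightarrow>
      (way_below D le u x \<^bold>\<or> \<^bold>\<not> le v x))"


section \<open>Lower reals\<close>

definition lower_real :: "(rat \<Rightarrow> 'h::complete_heyting_algebra) \<Rightarrow> 'h"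
  where "lower_real L =
    ((\<^bold>\<forall>q. \<^bold>\<forall>p. q \<^bold>< p \<^bold>\<and> L p \<^bold>\<longrightarrow> L q) \<^bold>\<and>
     (\<^bold>\<exists>p. L p) \<^bold>\<and>
     (\<^bold>\<forall>p. \<^bold>\<forall>q. L p \<^bold>\<and> L q \<^bold>\<longrightarrow> (\<^bold>\<exists>r. L r \<^bold>\<and> p \<^bold>< r \<^bold>\<and> q \<^bold>< r)))"

definition incl ::
  "(rat \<Rightarrow> 'h::complete_heyting_algebra) \<Rightarrow> (rat \<Rightarrow> 'h) \<Rightarrow> 'h"
  where "incl L M = (\<^bold>\<forall>q. L q \<^bold>\<longrightarrow> M q)"

definition upper_of :: "(rat \<Rightarrow> 'h::complete_heyting_algebra) \<Rightarrow> rat \<Rightarrow> 'h"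
  where "upper_of L q = (\<^bold>\<exists>s. \<^bold>\<not> L s \<^bold>\<and> s \<^bold>< q)"

definition located ::
  "(rat \<Rightarrow> 'h::complete_heyting_algebra) \<Rightarrow> (rat \<Rightarrow> 'h) \<Rightarrow> 'h"
  where "located L U = (\<^bold>\<forall>p. \<^bold>\<forall>q. p \<^bold>< q \<^bold>\<longrightarrow> (L p \<^bold>\<or> U q))"

end

theory Submission
  imports Defs
begin

text \<open>
  Write \<open>\<down>q\<close> for the lower real of all rationals below \<open>q\<close>. Every lower real \<open>v\<close> is the
  directed union of the \<open>\<down>q\<close> with \<open>q \<in> v\<close>, so \<open>u \<lless> v\<close> means that \<open>u \<subseteq> \<down>q\<close> for some
  \<open>q \<in> v\<close>. If \<open>L\<close> is sharp and \<open>p < q\<close>, sharpness for \<open>\<down>p \<lless> \<down>m\<close> with \<open>p < m < q\<close> gives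
  \<open>p \<in> L\<close> or \<open>m \<notin> L\<close>. Conversely, let \<open>u \<subseteq> \<down>q\<close> with \<open>q \<in> v\<close> and choose \<open>q' \<in> v\<close> above \<open>q\<close>;
  locatedness for \<open>q < q'\<close> gives \<open>q \<in> L\<close>, hence \<open>u \<lless> L\<close>, or some \<open>s < q'\<close> outside \<open>L\<close>,
  and then \<open>s \<in> v\<close> shows \<open>\<not> v \<subseteq> L\<close>.

  The argument is intuitionistic and is carried out in Kripke--Joyal style: \<open>c \<le> P\<close> is read
  as ``\<open>c\<close> forces \<open>P\<close>'', and passing to some \<open>d \<le> c\<close> plays the role of adding hypotheses.
\<close>

section \<open>Forcing\<close>

text \<open>The Kripke clause for implication: the premise may become true only at a later stage
  \<open>d\<close>. The proof tests the single stage \<open>inf c a\<close>.\<close>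

lemma himp_forceI:
  assumes "\<And>d. d \<le> c \<Longrightarrow> d \<le> a \<Longrightarrow> d \<le> b"
  shows "c \<le> (a \<^bold>\<longrightarrow> b)"
  unfolding le_himp_iff by (rule assms) simp_all

lemma himp_forceD: "c \<le> (a \<^bold>\<longrightarrow> b) \<Longrightarrow> c \<le> a \<Longrightarrow> c \<le> b"
  unfolding le_himp_iff by (metis inf.absorb1)

lemma hall_forceD: "c \<le> (\<^bold>\<forall>x. P x) \<Longrightarrow> c \<le> P x"
  by (erule order_trans) (rule INF_lower, rule UNIV_I)

lemma hall_forceI: "(\<And>x. c \<le> P x) \<Longrightarrow> c \<le> (\<^bold>\<forall>x. P x)"
  by (rule INF_greatest)

lemma hex_forceI: "c \<le> P x \<Longrightarrow> c \<le> (\<^bold>\<exists>x. P x)"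
  by (erule order_trans) (rule SUP_upper, rule UNIV_I)

text \<open>A forced existential gives no single witness valid on all of \<open>c\<close>; witnesses
  are only local, hence the smaller stages \<open>d\<close>. They are glued by residuation: every
  \<open>P x\<close> lies below the implication from \<open>c\<close> to \<open>r\<close>, so their
  supremum does too.\<close>

lemma hex_forceE:
  assumes "c \<le> (\<^bold>\<exists>x. P x)" and "\<And>x d. d \<le> c \<Longrightarrow> d \<le> P x \<Longrightarrow> d \<le> r"
  shows "c \<le> r"
proof -
  have "(\<^bold>\<exists>x. P x) \<le> (c \<^bold>\<longrightarrow> r)"
  proof (rule SUP_least)
    fix x
    have "inf (P x) c \<le> r" by (rule assms(2)[of _ x]) simp_all
    then show "P x \<le> (c \<^bold>\<longrightarrow> r)" by (simp add: le_himp_iff)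
  qed
  with assms(1) have "c \<le> (c \<^bold>\<longrightarrow> r)" by (rule order_trans)
  then show ?thesis by (rule himp_forceD) simp
qed

lemma hdisj_forceE:
  assumes "c \<le> (a \<^bold>\<or> b)" and "\<And>d. d \<le> c \<Longrightarrow> d \<le> a \<Longrightarrow> d \<le> r" and "\<And>d. d \<le> c \<Longrightarrow> d \<le> b \<Longrightarrow> d \<le> r"
  shows "c \<le> r"
proof -
  have "a \<le> (c \<^bold>\<longrightarrow> r)" "b \<le> (c \<^bold>\<longrightarrow> r)"
    using assms(2,3) by (auto simp: le_himp_iff)
  then have "c \<le> (c \<^bold>\<longrightarrow> r)"
    using assms(1) by (meson le_sup_iff order_trans)
  then show ?thesis by (rule himp_forceD) simp
qed

lemma hless_forceI: "p < q \<Longrightarrow> c \<le> (p \<^bold>< q)"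
  by (simp add: hless_def)

text \<open>The order on rationals is decidable: its truth value is \<open>top\<close> or
  \<open>bot\<close>, and in the second case \<open>c\<close> is \<open>bot\<close>, which forces
  everything. So a forced inequality may be used as an ordinary one.\<close>

lemma hless_forceE: "c \<le> (p \<^bold>< q) \<Longrightarrow> (p < q \<Longrightarrow> c \<le> r) \<Longrightarrow> c \<le> r"
  by (cases "p < q") (auto simp: hless_def bot_unique)

section \<open>Lower reals\<close>

lemma lower_real_forceI:
  assumes "\<And>p q d. d \<le> c \<Longrightarrow> q < p \<Longrightarrow> d \<le> L p \<Longrightarrow> d \<le> L q"
    and "c \<le> (\<^bold>\<exists>p. L p)"
    and "\<And>p q d. d \<le> c \<Longrightarrow> d \<le> L p \<Longrightarrow> d \<le> L q \<Longrightarrow> d \<le> (\<^bold>\<exists>r. L r \<^bold>\<and> p \<^bold>< r \<^bold>\<and> q \<^bold>< r)"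
  shows "c \<le> lower_real L"
  unfolding lower_real_def
proof (intro le_infI hall_forceI himp_forceI assms(2))
  fix p q d assume "d \<le> c" "d \<le> (q \<^bold>< p \<^bold>\<and> L p)"
  then have "d \<le> (q \<^bold>< p)" "d \<le> L p" by simp_all
  from this(1) show "d \<le> L q"
    by (rule hless_forceE) (rule assms(1)[OF \<open>d \<le> c\<close> _ \<open>d \<le> L p\<close>])
next
  fix p q d assume "d \<le> c" "d \<le> (L p \<^bold>\<and> L q)"
  then show "d \<le> (\<^bold>\<exists>r. L r \<^bold>\<and> p \<^bold>< r \<^bold>\<and> q \<^bold>< r)"
    unfolding le_inf_iff by (elim conjE) (rule assms(3))
qed

lemma lower_real_inhabited: "c \<le> lower_real L \<Longrightarrow> c \<le> (\<^bold>\<exists>p. L p)"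
  unfolding lower_real_def by simp

lemma lower_real_down:
  assumes "c \<le> lower_real L" "c \<le> L p" "q < p"
  shows "c \<le> L q"
proof -
  have "c \<le> (\<^bold>\<forall>q. \<^bold>\<forall>p. q \<^bold>< p \<^bold>\<and> L p \<^bold>\<longrightarrow> L q)"
    using assms(1) unfolding lower_real_def by simp
  from hall_forceD[OF hall_forceD[OF this, of q], of p] show ?thesis
    by (rule himp_forceD) (intro le_infI hless_forceI assms)
qed

text \<open>Directedness as an elimination rule. Applied with \<open>p\<close> and \<open>q\<close>
  equal it yields roundedness: a strictly larger element of \<open>L\<close>.\<close>

lemma lower_real_up:
  assumes "c \<le> lower_real L" "c \<le> L p" "c \<le> L q"
    and "\<And>r d. d \<le> c \<Longrightarrow> d \<le> L r \<Longrightarrow> p < r \<Longrightarrow> q < r \<Longrightarrow> d \<le> a"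
  shows "c \<le> a"
proof -
  have "c \<le> (\<^bold>\<forall>p. \<^bold>\<forall>q. L p \<^bold>\<and> L q \<^bold>\<longrightarrow> (\<^bold>\<exists>r. L r \<^bold>\<and> p \<^bold>< r \<^bold>\<and> q \<^bold>< r))"
    using assms(1) unfolding lower_real_def by simp
  from hall_forceD[OF hall_forceD[OF this, of p], of q]
  have "c \<le> (\<^bold>\<exists>r. L r \<^bold>\<and> p \<^bold>< r \<^bold>\<and> q \<^bold>< r)"
    by (rule himp_forceD) (intro le_infI assms)
  then show ?thesis
  proof (rule hex_forceE)
    fix r d assume d: "d \<le> c" "d \<le> (L r \<^bold>\<and> p \<^bold>< r \<^bold>\<and> q \<^bold>< r)"
    then have r: "d \<le> L r" "d \<le> (p \<^bold>< r)" "d \<le> (q \<^bold>< r)" by simp_all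
    show "d \<le> a"
      by (rule hless_forceE[OF r(2)], rule hless_forceE[OF r(3)]) (rule assms(4)[OF d(1) r(1)])
  qed
qed

lemma incl_forceI:
  assumes "\<And>q d. d \<le> c \<Longrightarrow> d \<le> L q \<Longrightarrow> d \<le> M q"
  shows "c \<le> incl L M"
  unfolding incl_def by (intro hall_forceI himp_forceI assms)

lemma incl_forceD: "c \<le> incl L M \<Longrightarrow> c \<le> L q \<Longrightarrow> c \<le> M q"
  unfolding incl_def by (drule hall_forceD[of _ _ q]) (rule himp_forceD)

lemma incl_refl: "c \<le> incl L L"
  by (rule incl_forceI)

lemma incl_trans:
  assumes "c \<le> incl L M" "c \<le> incl M N"
  shows "c \<le> incl L N"
proof (rule incl_forceI)
  fix q d assume d: "d \<le> c" "d \<le> L q"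
  show "d \<le> N q"
    by (rule incl_forceD[OF order_trans[OF d(1) assms(2)]], rule incl_forceD[OF order_trans[OF d(1) assms(1)]], rule d(2))
qed

text \<open>The rational \<open>q\<close> embedded as a principal ideal. Since the order is strict,
  \<open>q\<close> itself is not a member, so roundedness is needed whenever \<open>q\<close> has to
  be covered.\<close>

abbreviation below :: "rat \<Rightarrow> rat \<Rightarrow> 'h::complete_heyting_algebra" ("\<down>")
  where "\<down> q \<equiv> (\<lambda>p. p \<^bold>< q)"

lemma lower_real_below:
  fixes c :: "'h::complete_heyting_algebra"
  shows "c \<le> lower_real (\<down> q)"
proof (rule lower_real_forceI)
  show "c \<le> (\<^bold>\<exists>p. p \<^bold>< q)"
    by (rule hex_forceI[where x = "q - 1"]) (simp add: hless_forceI)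
next
  fix p p' and d :: 'h assume "d \<le> (p \<^bold>< q)" "d \<le> (p' \<^bold>< q)"
  then show "d \<le> (\<^bold>\<exists>r. r \<^bold>< q \<^bold>\<and> p \<^bold>< r \<^bold>\<and> p' \<^bold>< r)"
  proof (elim hless_forceE)
    assume "p < q" "p' < q"
    then obtain r where "max p p' < r" "r < q"
      using dense[of "max p p'" q] by auto
    then show "d \<le> (\<^bold>\<exists>r. r \<^bold>< q \<^bold>\<and> p \<^bold>< r \<^bold>\<and> p' \<^bold>< r)"
      by (intro hex_forceI[where x = r]) (simp add: hless_def)
  qed
qed (auto simp: hless_def bot_unique)

text \<open>If \<open>q < p\<close>, then \<open>q\<close> belongs to \<down> p but not to \<down>
  q, so only the inconsistent stage \<open>bot\<close> can force the inclusion.\<close>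

lemma below_incl_iff: "c \<le> incl (\<down> p) (\<down> q) \<longleftrightarrow> c = bot \<or> p \<le> q"
proof
  assume "c \<le> incl (\<down> p) (\<down> q)"
  from incl_forceD[OF this, of q] show "c = bot \<or> p \<le> q"
    by (auto simp: hless_def bot_unique not_le)
next
  assume "c = bot \<or> p \<le> q"
  then show "c \<le> incl (\<down> p) (\<down> q)"
    by (auto intro!: incl_forceI simp: hless_def bot_unique)
qed

lemma below_incl:
  assumes "c \<le> lower_real L" "c \<le> L q"
  shows "c \<le> incl (\<down> q) L"
proof (rule incl_forceI)
  fix p d assume d: "d \<le> c" "d \<le> (p \<^bold>< q)"
  have "d \<le> lower_real L" "d \<le> L q" using d(1) assms by order+
  from d(2) show "d \<le> L p"
    by (rule hless_forceE) (rule lower_real_down[OF \<open>d \<le> lower_real L\<close> \<open>d \<le> L q\<close>])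
qed

section \<open>The way-below relation\<close>

lemma directed_carrier:
  assumes "c \<le> directed_in D le S" "c \<le> S s"
  shows "c \<le> D s"
proof -
  have "c \<le> (\<^bold>\<forall>x. S x \<^bold>\<longrightarrow> D x)"
    using assms(1) unfolding directed_in_def subset_of_def by simp
  from himp_forceD[OF hall_forceD[OF this] assms(2)] show ?thesis .
qed

lemma directed_inhabited: "c \<le> directed_in D le S \<Longrightarrow> c \<le> (\<^bold>\<exists>x. S x)"
  unfolding directed_in_def by simp

lemma directed_upper_bound:
  assumes "c \<le> directed_in D le S" "c \<le> S x" "c \<le> S y"
  shows "c \<le> (\<^bold>\<exists>z. S z \<^bold>\<and> le x z \<^bold>\<and> le y z)"
proof -
  have "c \<le> (\<^bold>\<forall>x. \<^bold>\<forall>y. S x \<^bold>\<and> S y \<^bold>\<longrightarrow> (\<^bold>\<exists>z. S z \<^bold>\<and> le x z \<^bold>\<and> le y z))"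
    using assms(1) unfolding directed_in_def by simp
  from hall_forceD[OF hall_forceD[OF this, of x], of y] show ?thesis
    by (rule himp_forceD) (intro le_infI assms)
qed

lemma lower_real_directed_union:
  assumes S: "c \<le> directed_in lower_real incl S"
  shows "c \<le> lower_real (\<lambda>q. \<^bold>\<exists>s. S s \<^bold>\<and> s q)" (is "c \<le> lower_real ?W")
proof (rule lower_real_forceI)
  show "c \<le> (\<^bold>\<exists>p. ?W p)"
  proof (rule hex_forceE[OF directed_inhabited[OF S]])
    fix s d assume d: "d \<le> c" "d \<le> S s"
    have "d \<le> lower_real s" by (rule directed_carrier[OF order_trans[OF d(1) S], OF d(2)])
    from lower_real_inhabited[OF this] show "d \<le> (\<^bold>\<exists>p. ?W p)"
    proof (rule hex_forceE)
      fix p e assume e: "e \<le> d" "e \<le> s p"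
      show "e \<le> (\<^bold>\<exists>p. ?W p)"
        by (rule hex_forceI[where x = p], rule hex_forceI[where x = s])
          (intro le_infI order_trans[OF e(1) d(2)] e(2))
    qed
  qed
next
  fix p q d assume d: "d \<le> c" "q < p" "d \<le> ?W p"
  from d(3) show "d \<le> ?W q"
  proof (rule hex_forceE)
    fix s e assume e: "e \<le> d" "e \<le> (S s \<^bold>\<and> s p)"
    then have es: "e \<le> S s" "e \<le> s p" by simp_all
    have "e \<le> directed_in lower_real incl S" using e(1) d(1) S by order
    from directed_carrier[OF this, OF es(1)]
    have "e \<le> s q" using es(2) d(2) by (rule lower_real_down)
    with es(1) show "e \<le> ?W q" by (intro hex_forceI[where x = s] le_infI)
  qed
next
  fix p q d assume d: "d \<le> c" "d \<le> ?W p" "d \<le> ?W q"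
  let ?R = "\<^bold>\<exists>r. ?W r \<^bold>\<and> p \<^bold>< r \<^bold>\<and> q \<^bold>< r"
  from d(2) show "d \<le> ?R"
  proof (rule hex_forceE)
    fix s e assume e: "e \<le> d" "e \<le> (S s \<^bold>\<and> s p)"
    from e(1) d(3) have "e \<le> ?W q" by (rule order_trans)
    then show "e \<le> ?R"
    proof (rule hex_forceE)
      fix t f assume f: "f \<le> e" "f \<le> (S t \<^bold>\<and> t q)"
      have fc: "f \<le> directed_in lower_real incl S"
        using f(1) e(1) d(1) S by order
      have fs: "f \<le> S s" "f \<le> s p" "f \<le> S t" "f \<le> t q"
        using f(2) order_trans[OF f(1) e(2)] by simp_all
      \<comment> \<open>\<open>p\<close> and \<open>q\<close> come from different members
        \<open>s\<close> and \<open>t\<close>; a common upper bound \<open>z\<close> contains both,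
        and its own directedness provides \<open>r\<close>.\<close>
      from directed_upper_bound[OF fc, OF fs(1), OF fs(3)] show "f \<le> ?R"
      proof (rule hex_forceE)
        fix z g assume g: "g \<le> f" "g \<le> (S z \<^bold>\<and> incl s z \<^bold>\<and> incl t z)"
        then have gz: "g \<le> S z" "g \<le> incl s z" "g \<le> incl t z" by simp_all
        have "g \<le> lower_real z"
          by (rule directed_carrier[OF order_trans[OF g(1) fc], OF gz(1)])
        moreover have "g \<le> z p" "g \<le> z q"
          by (rule incl_forceD[OF gz(2), OF order_trans[OF g(1) fs(2)]])
            (rule incl_forceD[OF gz(3), OF order_trans[OF g(1) fs(4)]])
        ultimately show "g \<le> ?R"
        proof (rule lower_real_up)
          fix r h assume h: "h \<le> g" "h \<le> z r" "p < r" "q < r"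
          show "h \<le> ?R"
            by (rule hex_forceI[where x = r],
                intro le_infI hex_forceI[where x = z] hless_forceI h order_trans[OF h(1) gz(1)])
        qed
      qed
    qed
  qed
qed

text \<open>A supremum \<open>z\<close> is known only by its universal property, so it is compared
  with the union of \<open>S\<close>, a lower real above all members. Hence \<open>q\<close>, which
  lies in \<open>z\<close>, lies in some member \<open>s\<close>, and then \<down> q is included in
  \<open>s\<close>.\<close>

lemma way_belowI:
  assumes v: "c \<le> v q" and u: "c \<le> incl u (\<down> q)"
  shows "c \<le> way_below lower_real incl u v"
  unfolding way_below_def
proof (intro hall_forceI himp_forceI)
  fix S z d e
  assume d: "d \<le> c" "d \<le> directed_in lower_real incl S"
    and e: "e \<le> d" "e \<le> (is_sup lower_real incl S z \<^bold>\<and> incl v z)"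
  let ?W = "\<lambda>q. \<^bold>\<exists>s. S s \<^bold>\<and> s q"
  have eS: "e \<le> directed_in lower_real incl S" using d(2) e(1) by order
  have "e \<le> (\<^bold>\<forall>w. lower_real w \<^bold>\<and> (\<^bold>\<forall>x. S x \<^bold>\<longrightarrow> incl x w) \<^bold>\<longrightarrow> incl z w)"
    using e(2) unfolding is_sup_def by simp
  from hall_forceD[OF this, of ?W] have "e \<le> incl z ?W"
  proof (rule himp_forceD)
    have "f \<le> incl x ?W" if "f \<le> S x" for x f
    proof (rule incl_forceI)
      fix r g assume "g \<le> f" "g \<le> x r"
      with that show "g \<le> ?W r" by (intro hex_forceI[where x = x] le_infI) order+
    qed
    then show "e \<le> (lower_real ?W \<^bold>\<and> (\<^bold>\<forall>x. S x \<^bold>\<longrightarrow> incl x ?W))"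
      by (intro le_infI hall_forceI himp_forceI lower_real_directed_union[OF eS])
  qed
  moreover have "e \<le> v q" using e(1) d(1) v by order
  with e(2) have "e \<le> z q" by (auto intro: incl_forceD)
  ultimately have "e \<le> ?W q" by (rule incl_forceD)
  then show "e \<le> (\<^bold>\<exists>s. S s \<^bold>\<and> incl u s)"
  proof (rule hex_forceE)
    fix s f assume f: "f \<le> e" "f \<le> (S s \<^bold>\<and> s q)"
    then have fs: "f \<le> S s" "f \<le> s q" by simp_all
    have "f \<le> incl u (\<down> q)" using f(1) e(1) d(1) u by order
    moreover have "f \<le> incl (\<down> q) s"
      by (rule below_incl[OF directed_carrier[OF order_trans[OF f(1) eS], OF fs(1)] fs(2)])
    ultimately have "f \<le> incl u s" by (rule incl_trans)
    with fs(1) show "f \<le> (\<^bold>\<exists>s. S s \<^bold>\<and> incl u s)"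
      by (intro hex_forceI[where x = s] le_infI)
  qed
qed

text \<open>The converse of \<open>way_belowI\<close>, obtained by testing the way-below relation on
  the directed family of principal lower reals \<down> q with \<open>q\<close> in \<open>v\<close>,
  whose supremum is \<open>v\<close>.\<close>

lemma way_belowD:
  assumes uv: "c \<le> way_below lower_real incl u v" and v: "c \<le> lower_real v"
  shows "c \<le> (\<^bold>\<exists>q. v q \<^bold>\<and> incl u (\<down> q))"
proof -
  \<comment> \<open>The principal lower reals are closed up under mutual inclusion, because
    \<open>subset_of\<close> demands that a subset respect equality.\<close>
  define S where "S = (\<lambda>x. lower_real x \<^bold>\<and> (\<^bold>\<exists>q. v q \<^bold>\<and> incl x (\<down> q) \<^bold>\<and> incl (\<down> q) x))"
  have S_below: "d \<le> S (\<down> q)" if "d \<le> v q" for d q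
    unfolding S_def using that
    by (intro le_infI lower_real_below hex_forceI[where x = q] incl_refl)
  have S_E: "d \<le> a"
    if "d \<le> S x" "\<And>q e. e \<le> d \<Longrightarrow> e \<le> v q \<Longrightarrow> e \<le> incl x (\<down> q) \<Longrightarrow> e \<le> incl (\<down> q) x \<Longrightarrow> e \<le> a"
    for d x a
  proof -
    have "d \<le> (\<^bold>\<exists>q. v q \<^bold>\<and> incl x (\<down> q) \<^bold>\<and> incl (\<down> q) x)"
      using that(1) unfolding S_def by simp
    then show ?thesis
      by (rule hex_forceE) (unfold le_inf_iff, elim conjE, rule that(2))
  qed
  have subset: "c \<le> subset_of lower_real incl S"
    unfolding subset_of_def
  proof (intro le_infI hall_forceI himp_forceI)
    fix x y d assume d: "d \<le> (S x \<^bold>\<and> lower_real y \<^bold>\<and> incl x y \<^bold>\<and> incl y x)"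
    have "d \<le> S x" using d by simp
    then show "d \<le> S y"
    proof (rule S_E)
      fix q e assume e: "e \<le> d" "e \<le> v q" "e \<le> incl x (\<down> q)" "e \<le> incl (\<down> q) x"
      have "e \<le> incl y x" "e \<le> incl x y" "e \<le> lower_real y"
        using order_trans[OF e(1) d] by simp_all
      with e show "e \<le> S y"
        unfolding S_def by (intro le_infI hex_forceI[where x = q]) (assumption | rule incl_trans, assumption, assumption)+
    qed
  qed (simp add: S_def)
  have dir: "c \<le> directed_in lower_real incl S"
    unfolding directed_in_def
  proof (intro le_infI hall_forceI himp_forceI subset)
    show "c \<le> (\<^bold>\<exists>x. S x)"
      using lower_real_inhabited[OF v] by (rule hex_forceE) (rule hex_forceI, rule S_below)
    fix x y d assume d: "d \<le> c" "d \<le> (S x \<^bold>\<and> S y)"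
    let ?R = "\<^bold>\<exists>z. S z \<^bold>\<and> incl x z \<^bold>\<and> incl y z"
    from d(2) have "d \<le> S x" by simp
    then show "d \<le> ?R"
    proof (rule S_E)
      fix p e assume e: "e \<le> d" "e \<le> v p" "e \<le> incl x (\<down> p)"
      have "e \<le> S y" using order_trans[OF e(1) d(2)] by simp
      then show "e \<le> ?R"
      proof (rule S_E)
        fix q f assume f: "f \<le> e" "f \<le> v q" "f \<le> incl y (\<down> q)"
        have "f \<le> lower_real v" "f \<le> v p" using v f(1) e(1,2) d(1) by order+
        \<comment> \<open>Directedness of \<open>v\<close> supplies \<open>r\<close> above
          \<open>p\<close> and \<open>q\<close>, and \<down> r bounds both members.\<close>
        then show "f \<le> ?R" using f(2)
        proof (rule lower_real_up)
          fix r g assume g: "g \<le> f" "g \<le> v r" "p < r" "q < r"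
          have "g \<le> incl x (\<down> p)" "g \<le> incl y (\<down> q)" using g(1) f(1,3) e(3) by order+
          moreover have "g \<le> incl (\<down> p) (\<down> r)" "g \<le> incl (\<down> q) (\<down> r)"
            using g by (simp_all add: below_incl_iff)
          ultimately show "g \<le> ?R"
            by (intro hex_forceI[where x = "\<down> r"] le_infI S_below g(2)) (rule incl_trans, assumption+)+
        qed
      qed
    qed
  qed
  have "c \<le> is_sup lower_real incl S v"
    unfolding is_sup_def
  proof (intro le_infI hall_forceI himp_forceI v)
    fix x d assume d: "d \<le> c" "d \<le> S x"
    from d(2) show "d \<le> incl x v"
    proof (rule S_E)
      fix q e assume e: "e \<le> d" "e \<le> v q" "e \<le> incl x (\<down> q)"
      have "e \<le> lower_real v" using v d(1) e(1) by order
      from e(3) below_incl[OF this e(2)] show "e \<le> incl x v" by (rule incl_trans)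
    qed
  next
    fix w d assume d: "d \<le> c" "d \<le> (lower_real w \<^bold>\<and> (\<^bold>\<forall>x. S x \<^bold>\<longrightarrow> incl x w))"
    show "d \<le> incl v w"
    proof (rule incl_forceI)
      fix q e assume e: "e \<le> d" "e \<le> v q"
      have "e \<le> lower_real v" using v d(1) e(1) by order
      \<comment> \<open>Roundedness of \<open>v\<close>: \<down> q misses \<open>q\<close>, so a
        larger \<open>r\<close> in \<open>v\<close> is taken and \<open>q\<close> is found in
        \<down> r.\<close>
      then show "e \<le> w q" using e(2) e(2)
      proof (rule lower_real_up)
        fix r f assume f: "f \<le> e" "f \<le> v r" "q < r"
        have "f \<le> (\<^bold>\<forall>x. S x \<^bold>\<longrightarrow> incl x w)"
          using order_trans[OF order_trans[OF f(1) e(1)] d(2)] by simp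
        from himp_forceD[OF hall_forceD[OF this] S_below[OF f(2)]]
        show "f \<le> w q" by (rule incl_forceD) (rule hless_forceI[OF f(3)])
      qed
    qed
  qed
  \<comment> \<open>The way-below relation is instantiated at \<open>S\<close>, with
    \<open>v\<close> as its supremum and \<open>v\<close> included in itself.\<close>
  from himp_forceD[OF hall_forceD[OF himp_forceD[OF hall_forceD[OF uv[unfolded way_below_def]] dir]]
      le_infI[OF this incl_refl]]
  show ?thesis
  proof (rule hex_forceE)
    fix s d assume d: "d \<le> c" "d \<le> (S s \<^bold>\<and> incl u s)"
    then have "d \<le> S s" by simp
    then show "d \<le> (\<^bold>\<exists>q. v q \<^bold>\<and> incl u (\<down> q))"
    proof (rule S_E)
      fix q e assume e: "e \<le> d" "e \<le> v q" "e \<le> incl s (\<down> q)"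
      have "e \<le> incl u s" using order_trans[OF e(1) d(2)] by simp
      then have "e \<le> incl u (\<down> q)" using e(3) by (rule incl_trans)
      with e(2) show "e \<le> (\<^bold>\<exists>q. v q \<^bold>\<and> incl u (\<down> q))"
        by (intro hex_forceI[where x = q] le_infI)
    qed
  qed
qed

section \<open>Sharpness and locatedness\<close>

lemma sharp_imp_located:
  assumes L: "c \<le> lower_real L" and sharp: "c \<le> sharp lower_real incl L"
  shows "c \<le> located L (upper_of L)"
  unfolding located_def
proof (intro hall_forceI himp_forceI)
  fix p q d assume d: "d \<le> c" "d \<le> (p \<^bold>< q)"
  from d(2) show "d \<le> (L p \<^bold>\<or> upper_of L q)"
  proof (rule hless_forceE)
    assume "p < q"
    \<comment> \<open>The gap between \<open>p\<close> and \<open>m\<close> makes \<down> p way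
      below \<down> m; the gap between \<open>m\<close> and \<open>q\<close> lets \<open>m\<close>
      witness \<open>upper_of L q\<close>.\<close>
    then obtain m where m: "p < m" "m < q" using dense by blast
    have "d \<le> way_below lower_real incl (\<down> p) (\<down> m)"
      using m by (intro way_belowI[where q = p] hless_forceI incl_refl)
    then have "d \<le> (lower_real (\<down> p) \<^bold>\<and> lower_real (\<down> m) \<^bold>\<and> way_below lower_real incl (\<down> p) (\<down> m))"
      by (intro le_infI lower_real_below)
    from himp_forceD[OF hall_forceD[OF hall_forceD[OF order_trans[OF d(1) sharp[unfolded sharp_def]]]] this]
    have "d \<le> (way_below lower_real incl (\<down> p) L \<^bold>\<or> \<^bold>\<not> incl (\<down> m) L)" .
    then show ?thesis
    proof (rule hdisj_forceE)
      fix e assume e: "e \<le> d" "e \<le> way_below lower_real incl (\<down> p) L"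
      have eL: "e \<le> lower_real L" using e(1) d(1) L by order
      from way_belowD[OF e(2) eL] have "e \<le> L p"
      proof (rule hex_forceE)
        fix r f assume f: "f \<le> e" "f \<le> (L r \<^bold>\<and> incl (\<down> p) (\<down> r))"
        have fL: "f \<le> lower_real L" using f(1) eL by (rule order_trans)
        \<comment> \<open>The inclusion of \<down> p in \<down> r gives only
          \<open>p \<le> r\<close>, so \<open>p\<close> may be \<open>r\<close> itself, and the
          inconsistent stage is split off.\<close>
        from f(2) consider "f = bot" | "p = r" | "p < r"
          unfolding le_inf_iff below_incl_iff by fastforce
        then show "f \<le> L p"
          by cases (use f(2) lower_real_down[OF fL] in auto)
      qed
      then show "e \<le> (L p \<^bold>\<or> upper_of L q)" by (rule le_supI1)
    next
      fix e assume e: "e \<le> d" "e \<le> (\<^bold>\<not> incl (\<down> m) L)"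
      have "e \<le> (\<^bold>\<not> L m)"
      proof (rule himp_forceI)
        fix f assume f: "f \<le> e" "f \<le> L m"
        have "f \<le> lower_real L" using f(1) e(1) d(1) L by order
        from himp_forceD[OF order_trans[OF f(1) e(2)] below_incl[OF this f(2)]] show "f \<le> bot" .
      qed
      then have "e \<le> upper_of L q"
        unfolding upper_of_def using m by (intro hex_forceI[where x = m] le_infI hless_forceI)
      then show "e \<le> (L p \<^bold>\<or> upper_of L q)" by (rule le_supI2)
    qed
  qed
qed

lemma located_imp_sharp:
  assumes loc: "c \<le> located L (upper_of L)"
  shows "c \<le> sharp lower_real incl L"
  unfolding sharp_def
proof (intro hall_forceI himp_forceI)
  fix u v d assume d: "d \<le> c" "d \<le> (lower_real u \<^bold>\<and> lower_real v \<^bold>\<and> way_below lower_real incl u v)"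
  let ?R = "way_below lower_real incl u L \<^bold>\<or> \<^bold>\<not> incl v L"
  have v: "d \<le> lower_real v" and "d \<le> way_below lower_real incl u v" using d(2) by simp_all
  from way_belowD[OF this(2,1)] show "d \<le> ?R"
  proof (rule hex_forceE)
    fix q e assume e: "e \<le> d" "e \<le> (v q \<^bold>\<and> incl u (\<down> q))"
    have ev: "e \<le> lower_real v" "e \<le> v q" and eu: "e \<le> incl u (\<down> q)"
      using order_trans[OF e(1) v] e(2) by simp_all
    \<comment> \<open>Roundedness of \<open>v\<close> at \<open>q\<close> opens the gap from
      \<open>q\<close> to \<open>q'\<close> to which locatedness is applied.\<close>
    from ev ev(2) show "e \<le> ?R"
    proof (rule lower_real_up)
      fix q' f assume f: "f \<le> e" "f \<le> v q'" "q < q'"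
      have "f \<le> located L (upper_of L)" using f(1) e(1) d(1) loc by order
      from himp_forceD[OF hall_forceD[OF hall_forceD[OF this[unfolded located_def]]] hless_forceI[OF f(3)]]
      have "f \<le> (L q \<^bold>\<or> upper_of L q')" .
      then show "f \<le> ?R"
      proof (rule hdisj_forceE)
        fix g assume g: "g \<le> f" "g \<le> L q"
        \<comment> \<open>The rational \<open>q\<close> that separated \<open>u\<close> from
          \<open>v\<close> now separates \<open>u\<close> from \<open>L\<close>.\<close>
        have "g \<le> incl u (\<down> q)" using g(1) f(1) eu by order
        with g(2) show "g \<le> ?R" by (intro le_supI1 way_belowI)
      next
        fix g assume g: "g \<le> f" "g \<le> upper_of L q'"
        from g(2) have "g \<le> (\<^bold>\<not> incl v L)"
          unfolding upper_of_def
        proof (rule hex_forceE)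
          fix s h assume h: "h \<le> g" "h \<le> (\<^bold>\<not> L s \<^bold>\<and> s \<^bold>< q')"
          then have s: "h \<le> (\<^bold>\<not> L s)" "h \<le> (s \<^bold>< q')" by simp_all
          from s(2) show "h \<le> (\<^bold>\<not> incl v L)"
          proof (rule hless_forceE)
            assume sq: "s < q'"
            have "h \<le> lower_real v" "h \<le> v q'"
              using h(1) g(1) f(1,2) ev(1) by order+
            \<comment> \<open>Now \<open>s\<close> is in \<open>v\<close> but not in
              \<open>L\<close>, which refutes the inclusion of \<open>v\<close> in
              \<open>L\<close>.\<close>
            then have vs: "h \<le> v s" using sq by (rule lower_real_down)
            show "h \<le> (\<^bold>\<not> incl v L)"
            proof (rule himp_forceI)
              fix k assume k: "k \<le> h" "k \<le> incl v L"
              show "k \<le> bot"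
                by (rule himp_forceD[OF order_trans[OF k(1) s(1)] incl_forceD[OF k(2), OF order_trans[OF k(1) vs]]])
            qed
          qed
        qed
        then show "g \<le> ?R" by (rule le_supI2)
      qed
    qed
  qed
qed

theorem theorem7p22:
  fixes L :: "rat \<Rightarrow> 'h::complete_heyting_algebra"
  shows "holds (lower_real L \<^bold>\<longrightarrow> (sharp lower_real incl L \<^bold>\<longleftrightarrow> located L (upper_of L)))"
  unfolding holds_himp_iff
proof (intro le_infI himp_forceI)
  fix d assume d: "d \<le> lower_real L"
  show "d \<le> located L (upper_of L)" if "d \<le> sharp lower_real incl L"
    using d that by (rule sharp_imp_located)
  show "d \<le> sharp lower_real incl L" if "d \<le> located L (upper_of L)"
    using that by (rule located_imp_sharp)
qed

end
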